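(* Let $(h_\alpha)$, $\alpha\in\mathbb{R}$, be a parametrized family of distortion functions with $h_{\alpha_0}(y)=y$, applied to the prior distribution function $F_\vartheta$ (distortion of the prior only; the likelihood $\mathcal{L}$ is not distorted). Assume that for $\Pi$-almost every $\theta$ the map $\alpha\mapsto\log h'_\alpha(F_\vartheta(\theta))$ is differentiable at $\alpha=\alpha_0$. Let $\delta_0>0$, let $g:\Theta\to\mathbb{R}^s$ be measurable, and assume that for some $G(\cdot,\alpha_0)\in L^1(\Pi)$, $$\left|\delta^{-1}g(\theta)\mathcal{L}(\theta)\big(h'_{\alpha_0+\delta}(F_\vartheta(\theta))-h'_{\alpha_0}(F_\vartheta(\theta))\big)\right|\le G(\theta,\alpha_0),\qquad|\delta|\le\delta_0,$$ holds for $\Pi$-almost every $\theta$. Then the Bayesian local sensitivity $\delta_n^{h_\alpha}=\frac{\partial}{\partial\alpha}\mathrm{E}_{\Pi^n_{h_\alpha}}[g(\vartheta)]\big|_{\alpha=\alpha_0}$ satisfies $$\delta_n^{h_\alpha}=\mathrm{Cov}_{\Pi^n}\Big[g(\vartheta),\ \frac{\partial}{\partial\alpha}\log h'_\alpha(F_\vartheta(\vartheta))\Big|_{\alpha=\alpha_0}\Big].$$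
   Context: Setting: $\Theta\subseteq\mathbb{R}^k$ is the parameter space with prior probability distribution $\Pi$; $\vartheta$ is the random parameter with law $\Pi$, distribution function $F_\vartheta$ and density $f_\vartheta$. Given $\theta\in\Theta$, $X$ is an $\mathbb{R}^d$-valued random vector with distribution $P_\theta$, distribution function $F_X(\cdot|\theta)$ and density $f_X(\cdot|\theta)$. The sample $x_{1:n}=(x_1,\dots,x_n)$ is a fixed realisation of an i.i.d. sample of $X$. The likelihood is $\mathcal{L}(\theta)=\prod_{i=1}^n f_X(x_i|\theta)$, and $\Pi^n$ is the posterior, $d\Pi^n(\theta)=\mathcal{L}(\theta)d\Pi(\theta)/\int_\Theta\mathcal{L}\,d\Pi$ (Bayes' rule is assumed to be well defined). A distortion function is a differentiable, non-decreasing $h:[0,1]\to[0,1]$ with $h(0)=0$, $h(1)=1$; $h'$ denotes its derivative. The $h$-distorted prior $\Pi_h$ is the one with distribution function $h\circ F_\vartheta$, with density $f_\vartheta(\theta)h'(F_\vartheta(\theta))$, i.e. $d\Pi_h(\theta)=h'(F_\vartheta(\theta))\,d\Pi(\theta)$. The distorted posterior (prior distortion only) is $\Pi^n_{h}(B)=\int_B\mathcal{L}\,d\Pi_h/\int_\Theta\mathcal{L}\,d\Pi_h$. In $h'_\alpha$, the prime is the derivative in the argument $y$ of $h_\alpha(y)$. $\mathrm{Cov}_{\Pi^n}[g(\vartheta),T(\vartheta)]$ for $g$ valued in $\mathbb{R}^s$ and $T$ real-valued is the vector in $\mathbb{R}^s$ of covariances of the components of $g(\vartheta)$ with $T(\vartheta)$,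 for $\vartheta\sim\Pi^n$.
   Formalization: The domination condition is also assumed with the constant 1 in place of g (some G_1 in L^1(Pi), same delta_0), to differentiate the normalising constant, since the claim fails without it; g is explicitly assumed integrable under the posterior Pi^n. *)

theory Defs
  imports "HOL-Probability.Probability"
begin

(* The prior is a measure whose space is Theta, so that measurability of g : Theta -> R^s
   is measurability with respect to the prior, and integrals over Theta need no restriction. *)
locale bayesian_model = prob_space prior
  for \<Theta> :: "(real ^ 'k) set"
    and prior :: "(real ^ 'k) measure"
    and f\<^sub>\<theta> :: "real ^ 'k \<Rightarrow> real"
    and f\<^sub>X :: "real ^ 'k \<Rightarrow> real ^ 'd \<Rightarrow> real" +
  assumes Theta_borel: "\<Theta> \<in> sets borel"
    and prior_density_nonneg: "\<And>\<theta>. \<theta> \<in> \<Theta> \<Longrightarrow> 0 \<le> f\<^sub>\<theta> \<theta>"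
    and prior_density_measurable: "f\<^sub>\<theta> \<in> borel_measurable (restrict_space borel \<Theta>)"
    and prior_eq: "prior = density (restrict_space lborel \<Theta>) (\<lambda>\<theta>. ennreal (f\<^sub>\<theta> \<theta>))"
    and model_density_nonneg: "\<And>\<theta> x. \<theta> \<in> \<Theta> \<Longrightarrow> 0 \<le> f\<^sub>X \<theta> x"
    and model_density_measurable: "\<And>\<theta>. \<theta> \<in> \<Theta> \<Longrightarrow> f\<^sub>X \<theta> \<in> borel_measurable borel"
    and model_prob_space: "\<And>\<theta>. \<theta> \<in> \<Theta> \<Longrightarrow> prob_space (density lborel (\<lambda>x. ennreal (f\<^sub>X \<theta> x)))"
    and model_density_measurable_param:
      "\<And>x. (\<lambda>\<theta>. f\<^sub>X \<theta> x) \<in> borel_measurable (restrict_space borel \<Theta>)"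

definition likelihood ::
    "('p \<Rightarrow> 'x \<Rightarrow> real) \<Rightarrow> nat \<Rightarrow> (nat \<Rightarrow> 'x) \<Rightarrow> 'p \<Rightarrow> real" where
  "likelihood p n x \<theta> = (\<Prod>i=1..n. p \<theta> (x i))"

(* The order on real ^ 'k is componentwise. *)
definition distribution_fun :: "(real ^ 'k) measure \<Rightarrow> real ^ 'k \<Rightarrow> real" where
  "distribution_fun M \<theta> = measure M {t \<in> space M. t \<le> \<theta>}"

(* Only the values on [0,1] matter; the derivative is one-sided at 0 and 1. *)
definition distortion_function :: "(real \<Rightarrow> real) \<Rightarrow> bool" where
  "distortion_function h \<longleftrightarrow>
     h ` {0..1} \<subseteq> {0..1} \<and> h differentiable_on {0..1} \<and> mono_on {0..1} h \<and> h 0 = 0 \<and> h 1 = 1"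

definition distortion_deriv :: "(real \<Rightarrow> real) \<Rightarrow> real \<Rightarrow> real" where
  "distortion_deriv h y = vector_derivative h (at y within {0..1})"

(* For k = 1 this is the measure with distribution function h o F. For k > 1 it need not have
   total mass 1, which is harmless since the posterior normalises. *)
definition distorted_prior :: "(real \<Rightarrow> real) \<Rightarrow> (real ^ 'k) measure \<Rightarrow> (real ^ 'k) measure" where
  "distorted_prior h M =
     density M (\<lambda>\<theta>. ennreal (distortion_deriv h (distribution_fun M \<theta>)))"

definition posterior :: "'p measure \<Rightarrow> ('p \<Rightarrow> real) \<Rightarrow> 'p measure" where
  "posterior M L = density M (\<lambda>\<theta>. ennreal (L \<theta> / (\<integral>t. L t \<partial>M)))"

(* The integrals are taken in the completion because T will be a derivative that exists only
   almost everywhere: its arbitrary values on a null set may destroy Borel measurability, which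
   would make the Bochner integral over M vanish by convention. For Borel measurable
   integrands, integrals over M and over its completion agree. *)
definition Cov :: "'p measure \<Rightarrow> ('p \<Rightarrow> real ^ 's) \<Rightarrow> ('p \<Rightarrow> real) \<Rightarrow> real ^ 's" where
  "Cov M g T = (\<chi> j. \<integral>\<theta>. (g \<theta> $ j - (\<integral>t. g t $ j \<partial>completion M)) *
                          (T \<theta> - (\<integral>t. T t \<partial>completion M)) \<partial>completion M)"

definition posterior_mean ::
    "(real \<Rightarrow> real) \<Rightarrow> (real ^ 'k) measure \<Rightarrow> (real ^ 'k \<Rightarrow> real) \<Rightarrow> (real ^ 'k \<Rightarrow> real ^ 's) \<Rightarrow> real ^ 's"
  where "posterior_mean h M L g = (\<integral>\<theta>. g \<theta> \<partial>posterior (distorted_prior h M) L)"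

definition local_sensitivity ::
    "(real \<Rightarrow> real \<Rightarrow> real) \<Rightarrow> real \<Rightarrow> (real ^ 'k) measure \<Rightarrow> (real ^ 'k \<Rightarrow> real) \<Rightarrow>
     (real ^ 'k \<Rightarrow> real ^ 's) \<Rightarrow> real ^ 's" where
  "local_sensitivity h \<alpha>\<^sub>0 M L g = vector_derivative (\<lambda>\<alpha>. posterior_mean (h \<alpha>) M L g) (at \<alpha>\<^sub>0)"

end

theory Submission
  imports Defs
begin

text \<open>
  Writing \<open>D\<^sub>\<alpha> = h'\<^sub>\<alpha> \<circ> F\<close>, the distorted posterior mean is the quotient of
  \<open>N(\<alpha>) = \<integral> L D\<^sub>\<alpha> g d\<Pi>\<close> and \<open>Z(\<alpha>) = \<integral> L D\<^sub>\<alpha> d\<Pi>\<close>. Dominated convergence differentiates both under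
  the integral sign. Since \<open>D\<^sub>\<alpha> = 1\<close> at \<open>\<alpha>\<^sub>0\<close>, the derivative of \<open>D\<^sub>\<alpha>\<close> there is the derivative
  \<open>T\<close> of \<open>log D\<^sub>\<alpha>\<close>, and the quotient rule yields \<open>E[T g] - E[T] E[g]\<close> under the posterior.
\<close>

section \<open>Difference quotients and differentiation under the integral sign\<close>

text \<open>Dominated convergence, sign and measurability arguments all act on difference quotients.
  The codomain is a normed space for the sake of the vector-valued \<open>g\<close>, and
  \<open>within S\<close> covers the one-sided derivatives at 0 and 1.\<close>

lemma has_vector_derivative_iff_quotient_tendsto:
  fixes f :: "real \<Rightarrow> 'b::real_normed_vector"
  shows "(f has_vector_derivative D) (at a within S) \<longleftrightarrow>
    ((\<lambda>y. (f y - f a) /\<^sub>R (y - a)) \<longlongrightarrow> D) (at a within S)"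
proof -
  have "(f has_vector_derivative D) (at a within S) \<longleftrightarrow>
      ((\<lambda>y. norm (f y - f a - (y - a) *\<^sub>R D) / norm (y - a)) \<longlongrightarrow> 0) (at a within S)"
    by (simp add: has_vector_derivative_def has_derivative_iff_norm bounded_linear_scaleR_left)
  also have "\<dots> \<longleftrightarrow> ((\<lambda>y. norm ((f y - f a) /\<^sub>R (y - a) - D)) \<longlongrightarrow> 0) (at a within S)"
  proof (rule filterlim_cong[OF refl refl])
    have "norm (f y - f a - (y - a) *\<^sub>R D) / norm (y - a) = norm ((f y - f a) /\<^sub>R (y - a) - D)"
      if "y \<noteq> a" for y
    proof -
      have "(f y - f a) /\<^sub>R (y - a) - D = (f y - f a - (y - a) *\<^sub>R D) /\<^sub>R (y - a)"
        using that by (simp add: scaleR_diff_right)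
      then show ?thesis
        by (simp add: divide_inverse mult.commute)
    qed
    then show "\<forall>\<^sub>F y in at a within S. norm (f y - f a - (y - a) *\<^sub>R D) / norm (y - a) =
        norm ((f y - f a) /\<^sub>R (y - a) - D)"
      by (simp add: eventually_at_filter)
  qed
  also have "\<dots> \<longleftrightarrow> ((\<lambda>y. (f y - f a) /\<^sub>R (y - a)) \<longlongrightarrow> D) (at a within S)"
    by (simp add: tendsto_norm_zero_iff LIM_zero_iff)
  finally show ?thesis .
qed

text \<open>Dominated convergence, applied to the difference quotients along sequences tending to
  \<open>a\<close>. Integrability is assumed at \<open>a\<close> only: nearby it follows from the
  bound, because \<open>f y\<close> is \<open>f a\<close> plus a multiple of a dominated
  quotient.\<close>

lemma
  fixes f :: "real \<Rightarrow> 'a \<Rightarrow> 'b::{banach, second_countable_topology}"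
  assumes meas: "\<And>y. f y \<in> borel_measurable M"
    and meas': "f' \<in> borel_measurable M"
    and int: "integrable M (f a)"
    and deriv: "AE t in M. ((\<lambda>y. f y t) has_vector_derivative f' t) (at a)"
    and r: "0 < r"
    and w: "integrable M w"
    and bound: "AE t in M. \<forall>y. y \<noteq> a \<and> \<bar>y - a\<bar> \<le> r \<longrightarrow> norm ((f y t - f a t) /\<^sub>R (y - a)) \<le> w t"
  shows integrable_dominated_derivative: "integrable M f'"
    and has_vector_derivative_integral_dominated:
      "((\<lambda>y. \<integral>t. f y t \<partial>M) has_vector_derivative (\<integral>t. f' t \<partial>M)) (at a)"
proof -
  let ?q = "\<lambda>y t. (f y t - f a t) /\<^sub>R (y - a)"
  have q_meas [measurable]: "?q y \<in> borel_measurable M" for y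
    using meas by measurable
  have q_bound: "AE t in M. norm (?q y t) \<le> w t" if "y \<noteq> a" "\<bar>y - a\<bar> \<le> r" for y
    using bound that by auto
  \<comment> \<open>Used twice: one explicit sequence yields integrability of \<open>f'\<close>, and
    the tails of an arbitrary sequence yield the limit.\<close>
  have conv: "integrable M f' \<and> (\<lambda>i. \<integral>t. ?q (X i) t \<partial>M) \<longlonglongrightarrow> (\<integral>t. f' t \<partial>M)"
    if X: "X \<longlonglongrightarrow> a" "\<And>i. X i \<noteq> a" "\<And>i. \<bar>X i - a\<bar> \<le> r" for X
  proof -
    have lim: "AE t in M. (\<lambda>i. ?q (X i) t) \<longlonglongrightarrow> f' t"
      using deriv
    proof eventually_elim
      case (elim t)
      then have "((\<lambda>y. ?q y t) \<longlongrightarrow> f' t) (at a)"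
        by (simp add: has_vector_derivative_iff_quotient_tendsto)
      moreover have "filterlim X (at a) sequentially"
        using X by (auto simp: filterlim_at)
      ultimately show ?case
        by (rule filterlim_compose)
    qed
    have dom: "AE t in M. norm (?q (X i) t) \<le> w t" for i
      using X by (intro q_bound)
    show ?thesis
      using integrable_dominated_convergence[OF meas' q_meas w lim dom]
        integral_dominated_convergence[OF meas' q_meas w lim dom] by blast
  qed
  \<comment> \<open>A witness that admissible sequences exist; with \<open>Suc i\<close> the first
    term is \<open>a + r\<close>, where the bound still holds.\<close>
  define X\<^sub>0 where "X\<^sub>0 i = a + r / real (Suc i)" for i
  have "X\<^sub>0 \<longlonglongrightarrow> a"
    unfolding X\<^sub>0_def
    using tendsto_add[OF tendsto_const[of a]
        tendsto_mult[OF tendsto_const[of r] LIMSEQ_inverse_real_of_nat]]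
    by (simp add: divide_inverse)
  moreover have "X\<^sub>0 i \<noteq> a" "\<bar>X\<^sub>0 i - a\<bar> \<le> r" for i
    using r by (auto simp: X\<^sub>0_def field_simps)
  ultimately show "integrable M f'"
    using conv[of X\<^sub>0] by blast
  \<comment> \<open>The Bochner integral is linear on integrable functions only, so this is what
    later splits the integral of the quotient into a difference.\<close>
  have int_f: "integrable M (f y)" if "y \<noteq> a" "\<bar>y - a\<bar> \<le> r" for y
  proof -
    have "integrable M (?q y)"
      using q_bound[OF that] by (intro Bochner_Integration.integrable_bound[OF w q_meas]) auto
    then have "integrable M (\<lambda>t. f a t + (y - a) *\<^sub>R ?q y t)"
      by (rule Bochner_Integration.integrable_add[OF int integrable_scaleR_right])
    moreover have "(\<lambda>t. f a t + (y - a) *\<^sub>R ?q y t) = f y"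
      using that by simp
    ultimately show ?thesis
      by (simp only:)
  qed
  have "((\<lambda>y. ((\<integral>t. f y t \<partial>M) - (\<integral>t. f a t \<partial>M)) /\<^sub>R (y - a)) \<longlongrightarrow> (\<integral>t. f' t \<partial>M)) (at a)"
    unfolding tendsto_at_iff_sequentially
  proof (intro allI impI)
    fix X assume X: "\<forall>i. X i \<in> UNIV - {a}" "X \<longlonglongrightarrow> a"
    \<comment> \<open>The bound reaches only to distance \<open>r\<close> from \<open>a\<close>, so
      the first \<open>k\<close> terms are dropped; \<open>LIMSEQ_offset\<close> restores
      them.\<close>
    obtain k where k: "\<And>i. i \<ge> k \<Longrightarrow> \<bar>X i - a\<bar> < r"
      using X(2) r unfolding LIMSEQ_def dist_real_def by blast
    have Xk: "X (i + k) \<noteq> a" "\<bar>X (i + k) - a\<bar> \<le> r" for i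
      using X(1) k[of "i + k"] by auto
    have "(\<lambda>i. \<integral>t. ?q (X (i + k)) t \<partial>M) \<longlonglongrightarrow> (\<integral>t. f' t \<partial>M)"
      using conv[of "\<lambda>i. X (i + k)"] Xk X(2) LIMSEQ_ignore_initial_segment by blast
    moreover have "(\<integral>t. ?q (X (i + k)) t \<partial>M) =
        ((\<integral>t. f (X (i + k)) t \<partial>M) - (\<integral>t. f a t \<partial>M)) /\<^sub>R (X (i + k) - a)" for i
      using int_f[OF Xk] int by simp
    ultimately have "(\<lambda>i. ((\<lambda>y. ((\<integral>t. f y t \<partial>M) - (\<integral>t. f a t \<partial>M)) /\<^sub>R (y - a)) \<circ> X) (i + k))
        \<longlonglongrightarrow> (\<integral>t. f' t \<partial>M)"
      by (simp only: o_def)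
    then show "((\<lambda>y. ((\<integral>t. f y t \<partial>M) - (\<integral>t. f a t \<partial>M)) /\<^sub>R (y - a)) \<circ> X) \<longlonglongrightarrow> (\<integral>t. f' t \<partial>M)"
      by (rule LIMSEQ_offset)
  qed
  then show "((\<lambda>y. \<integral>t. f y t \<partial>M) has_vector_derivative (\<integral>t. f' t \<partial>M)) (at a)"
    by (simp add: has_vector_derivative_iff_quotient_tendsto)
qed

section \<open>Derivatives of distortion functions on the unit interval\<close>

lemma distortion_deriv_has_vector_derivative:
  assumes "distortion_function h" "y \<in> {0..1}"
  shows "(h has_vector_derivative distortion_deriv h y) (at y within {0..1})"
  using assms
  by (auto simp: distortion_function_def distortion_deriv_def differentiable_on_def
      vector_derivative_works[symmetric])

text \<open>By monotonicity every difference quotient inside the interval is nonnegative, on either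
  side of \<open>y\<close>, and the limit inherits the sign. This keeps \<open>ennreal\<close> from
  truncating the density of the distorted prior.\<close>

lemma distortion_deriv_nonneg:
  assumes h: "distortion_function h" and y: "y \<in> {0..1}"
  shows "0 \<le> distortion_deriv h y"
proof (rule tendsto_lowerbound)
  show "((\<lambda>z. (h z - h y) /\<^sub>R (z - y)) \<longlongrightarrow> distortion_deriv h y) (at y within {0..1})"
    using distortion_deriv_has_vector_derivative[OF assms]
    by (simp add: has_vector_derivative_iff_quotient_tendsto)
  have mono: "h u \<le> h v" if "u \<in> {0..1}" "v \<in> {0..1}" "u \<le> v" for u v
    using h that unfolding distortion_function_def by (auto intro: mono_onD[where A = "{0..1}"])
  have "0 \<le> (h z - h y) /\<^sub>R (z - y)" if "z \<in> {0..1}" for z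
  proof (cases "z \<le> y")
    case True
    then show ?thesis
      using mono[OF that y] by (simp add: mult_nonpos_nonpos)
  next
    case False
    then show ?thesis
      using mono[OF y that] by simp
  qed
  then show "\<forall>\<^sub>F z in at y within {0..1}. 0 \<le> (h z - h y) /\<^sub>R (z - y)"
    by (auto simp: eventually_at_filter)
  show "at y within {0..1} \<noteq> bot"
    using y by (simp add: trivial_limit_within islimpt_Icc)
qed

text \<open>Derivatives within a nondegenerate closed interval are unique, even at the end
  points.\<close>

lemma distortion_deriv_eq_1:
  assumes "\<And>y. y \<in> {0..1} \<Longrightarrow> h y = y" "y \<in> {0..1}"
  shows "distortion_deriv h y = 1"
proof -
  have "(h has_vector_derivative 1) (at y within {0..1})"
    by (rule has_vector_derivative_transform[OF assms(2) assms(1)])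
      (auto intro: has_vector_derivative_id)
  then show ?thesis
    unfolding distortion_deriv_def using assms(2)
    by (intro vector_derivative_within_closed_interval) auto
qed

text \<open>The derivative need not be continuous, but it is a pointwise limit of difference
  quotients, which are Borel because \<open>h\<close> is continuous on the interval.\<close>

lemma borel_measurable_distortion_deriv_comp:
  assumes h: "distortion_function h"
    and f [measurable]: "f \<in> borel_measurable M"
    and range: "\<And>t. t \<in> space M \<Longrightarrow> f t \<in> {0..1}"
  shows "(\<lambda>t. distortion_deriv h (f t)) \<in> borel_measurable M"
proof -
  \<comment> \<open>Nothing is known about \<open>h\<close> outside the unit interval; clamping the
    argument gives a function continuous on the whole line.\<close>
  define H where "H y = h (max 0 (min 1 y))" for y
  have "continuous_on {0..1} h"
    using h by (simp add: distortion_function_def differentiable_imp_continuous_on)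
  then have "continuous_on UNIV H"
    unfolding H_def by (rule continuous_on_compose2) (auto intro!: continuous_intros)
  then have [measurable]: "H \<in> borel_measurable borel"
    by (rule borel_measurable_continuous_onI)
  have H_eq: "H y = h y" if "y \<in> {0..1}" for y
    using that by (simp add: H_def)
  \<comment> \<open>The direction of the increment depends on \<open>y\<close>, so that \<open>p k y\<close> never leaves the interval.\<close>
  define e where "e k = 1 / real (k + 2)" for k
  define p where "p k y = (if y \<le> 1/2 then y + e k else y - e k)" for k y
  have [measurable]: "p k \<in> borel_measurable borel" for k
    unfolding p_def by measurable
  show ?thesis
  proof (rule borel_measurable_LIMSEQ_real)
    show "(\<lambda>t. (H (p k (f t)) - H (f t)) / (p k (f t) - f t)) \<in> borel_measurable M" for k
      by measurable
    fix t assume "t \<in> space M"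
    then have y: "f t \<in> {0..1}"
      by (rule range)
    define y where "y = f t"
    \<comment> \<open>The offset 2 in \<open>e\<close> is what gives the bound 1/2, so that a step
      from either half of the interval towards the other half stays inside.\<close>
    have small: "0 < e k" "e k \<le> 1/2" for k
      by (auto simp: e_def field_simps)
    have p_in: "p k y \<in> {0..1}" "p k y \<noteq> y" for k
      using y small[of k] by (auto simp: p_def y_def)
    have "(\<lambda>k. p k y) \<longlonglongrightarrow> y"
    proof -
      have "e \<longlonglongrightarrow> 0"
        unfolding e_def using LIMSEQ_ignore_initial_segment[OF lim_1_over_n] by blast
      then have "(\<lambda>k. y + e k) \<longlonglongrightarrow> y + 0" "(\<lambda>k. y - e k) \<longlonglongrightarrow> y - 0"
        by (intro tendsto_intros; assumption)+
      then show ?thesis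
        unfolding p_def by (cases "y \<le> 1/2") auto
    qed
    then have "filterlim (\<lambda>k. p k y) (at y within {0..1}) sequentially"
      using p_in by (auto simp: filterlim_at)
    moreover have "((\<lambda>z. (h z - h y) /\<^sub>R (z - y)) \<longlongrightarrow> distortion_deriv h y) (at y within {0..1})"
      using distortion_deriv_has_vector_derivative[OF h y]
      by (simp add: has_vector_derivative_iff_quotient_tendsto y_def)
    ultimately have "(\<lambda>k. (h (p k y) - h y) /\<^sub>R (p k y - y)) \<longlonglongrightarrow> distortion_deriv h y"
      by (rule filterlim_compose[rotated])
    then show "(\<lambda>k. (H (p k (f t)) - H (f t)) / (p k (f t) - f t)) \<longlonglongrightarrow> distortion_deriv h (f t)"
      using p_in(1) y by (simp add: H_eq y_def divide_inverse mult.commute)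
  qed
qed

section \<open>Measurability and range of the multivariate distribution function\<close>

text \<open>The pairs ordered componentwise form a measurable set in the product space, being cut
  out by finitely many coordinate inequalities. The distribution function is the measure of its
  sections, and section measures are measurable.\<close>

lemma borel_measurable_distribution_fun:
  fixes M :: "(real ^ 'k) measure"
  assumes "prob_space M" and coord: "(\<lambda>t. t) \<in> borel_measurable M"
  shows "distribution_fun M \<in> borel_measurable M"
proof -
  interpret prob_space M by fact
  have nth [measurable]: "(\<lambda>t. t $ i) \<in> borel_measurable M" for i
    using coord by (rule measurable_compose) (intro borel_measurable_continuous_onI continuous_intros)
  have "Measurable.pred (M \<Otimes>\<^sub>M M) (\<lambda>z. \<forall>i. snd z $ i \<le> fst z $ i)"
    by measurable
  then have "{z \<in> space (M \<Otimes>\<^sub>M M). \<forall>i. snd z $ i \<le> fst z $ i} \<in> sets (M \<Otimes>\<^sub>M M)"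
    by measurable
  from measurable_emeasure_Pair[OF this]
  have "(\<lambda>u. enn2real (emeasure M (Pair u -` {z \<in> space (M \<Otimes>\<^sub>M M). \<forall>i. snd z $ i \<le> fst z $ i})))
      \<in> borel_measurable M"
    by measurable
  also have "?this \<longleftrightarrow> ?thesis"
    unfolding distribution_fun_def measure_def less_eq_vec_def
    by (intro measurable_cong arg_cong[where f=enn2real] arg_cong2[where f=emeasure])
      (auto simp: space_pair_measure)
  finally show ?thesis .
qed

lemma distribution_fun_range:
  "prob_space M \<Longrightarrow> distribution_fun M t \<in> {0..1}"
  by (simp add: distribution_fun_def prob_space.prob_le_1)

section \<open>Integrals against the posterior and the distorted posterior\<close>

text \<open>A change of density followed by pulling out the constant normaliser. If the normaliser
  is 0, both sides are 0 by the convention for division, so the formula can be used at every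
  distortion parameter.\<close>

lemma integral_posterior:
  fixes g :: "'a \<Rightarrow> 'b::{banach, second_countable_topology}"
  assumes [measurable]: "L \<in> borel_measurable M" "g \<in> borel_measurable M"
    and nonneg: "AE t in M. 0 \<le> L t"
  shows "(\<integral>t. g t \<partial>posterior M L) = (\<integral>t. L t *\<^sub>R g t \<partial>M) /\<^sub>R (\<integral>t. L t \<partial>M)"
proof -
  have "0 \<le> (\<integral>t. L t \<partial>M)"
    using nonneg by (rule integral_nonneg_AE)
  then have "(\<integral>t. g t \<partial>posterior M L) = (\<integral>t. (L t / (\<integral>t. L t \<partial>M)) *\<^sub>R g t \<partial>M)"
    unfolding posterior_def using nonneg by (intro integral_density) auto
  also have "\<dots> = (\<integral>t. inverse (\<integral>t. L t \<partial>M) *\<^sub>R (L t *\<^sub>R g t) \<partial>M)"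
    by (simp add: divide_inverse mult.commute)
  finally show ?thesis
    by (simp only: integral_scaleR_right)
qed

text \<open>A positive normaliser is a nonzero constant factor and can be multiplied away. With
  normaliser 0 the posterior would be the null measure and the left side would carry no
  information.\<close>

lemma integrable_posterior_iff:
  fixes g :: "'a \<Rightarrow> 'b::{banach, second_countable_topology}"
  assumes [measurable]: "L \<in> borel_measurable M" "g \<in> borel_measurable M"
    and nonneg: "AE t in M. 0 \<le> L t" and pos: "0 < (\<integral>t. L t \<partial>M)"
  shows "integrable (posterior M L) g \<longleftrightarrow> integrable M (\<lambda>t. L t *\<^sub>R g t)"
proof -
  have "integrable (posterior M L) g \<longleftrightarrow> integrable M (\<lambda>t. (L t / (\<integral>t. L t \<partial>M)) *\<^sub>R g t)"
    unfolding posterior_def using nonneg pos by (intro integrable_density) auto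
  also have "(\<lambda>t. (L t / (\<integral>t. L t \<partial>M)) *\<^sub>R g t) = (\<lambda>t. inverse (\<integral>t. L t \<partial>M) *\<^sub>R (L t *\<^sub>R g t))"
    by (simp add: divide_inverse mult.commute)
  also have "integrable M \<dots> \<longleftrightarrow> integrable M (\<lambda>t. L t *\<^sub>R g t)"
  proof
    assume "integrable M (\<lambda>t. inverse (\<integral>t. L t \<partial>M) *\<^sub>R (L t *\<^sub>R g t))"
    then have "integrable M (\<lambda>t. (\<integral>t. L t \<partial>M) *\<^sub>R (inverse (\<integral>t. L t \<partial>M) *\<^sub>R (L t *\<^sub>R g t)))"
      by (rule integrable_scaleR_right)
    then show "integrable M (\<lambda>t. L t *\<^sub>R g t)"
      using pos by (simp flip: mult.assoc)
  qed (rule integrable_scaleR_right)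
  finally show ?thesis .
qed

lemma prob_space_posterior:
  assumes L: "integrable M L" and nonneg: "AE t in M. 0 \<le> L t" and pos: "0 < (\<integral>t. L t \<partial>M)"
  shows "prob_space (posterior M L)"
proof
  have [measurable]: "L \<in> borel_measurable M"
    using L by auto
  have "emeasure (posterior M L) (space (posterior M L)) =
      (\<integral>\<^sup>+t. ennreal (L t / (\<integral>t. L t \<partial>M)) \<partial>M)"
    by (simp add: posterior_def emeasure_density cong: nn_integral_cong)
  also have "\<dots> = ennreal (\<integral>t. L t / (\<integral>t. L t \<partial>M) \<partial>M)"
    using L nonneg pos by (intro nn_integral_eq_integral) auto
  finally show "emeasure (posterior M L) (space (posterior M L)) = 1"
    using pos by simp
qed

text \<open>The posterior is absolutely continuous with respect to \<open>M\<close>, so null sets of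
  \<open>M\<close> remain null.\<close>

lemma AE_posterior:
  assumes "L \<in> borel_measurable M" "AE t in M. P t"
  shows "AE t in posterior M L. P t"
  using assms unfolding posterior_def by (subst AE_density) auto

text \<open>Two successive changes of density, from the posterior to the distorted prior and from
  there to \<open>M\<close>. A total mass of the distorted prior other than 1 is absorbed by the
  quotient.\<close>

lemma posterior_mean_eq:
  fixes M :: "(real ^ 'k) measure" and g :: "real ^ 'k \<Rightarrow> real ^ 's"
    and h :: "real \<Rightarrow> real"
  defines "D \<equiv> \<lambda>t. distortion_deriv h (distribution_fun M t)"
  assumes D [measurable]: "D \<in> borel_measurable M"
    and D_nonneg: "\<And>t. t \<in> space M \<Longrightarrow> 0 \<le> D t"
    and [measurable]: "L \<in> borel_measurable M" "g \<in> borel_measurable M"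
    and L_nonneg: "\<And>t. t \<in> space M \<Longrightarrow> 0 \<le> L t"
  shows "posterior_mean h M L g = (\<integral>t. (L t * D t) *\<^sub>R g t \<partial>M) /\<^sub>R (\<integral>t. L t * D t \<partial>M)"
proof -
  have prior: "distorted_prior h M = density M (\<lambda>t. ennreal (D t))"
    by (simp add: distorted_prior_def D_def)
  have "AE t in density M (\<lambda>t. ennreal (D t)). 0 \<le> L t"
    using L_nonneg by (intro AE_I2) simp
  then have "posterior_mean h M L g =
      (\<integral>t. L t *\<^sub>R g t \<partial>density M (\<lambda>t. ennreal (D t))) /\<^sub>R
      (\<integral>t. L t \<partial>density M (\<lambda>t. ennreal (D t)))"
    unfolding posterior_mean_def prior by (intro integral_posterior) auto
  also have "(\<integral>t. L t *\<^sub>R g t \<partial>density M (\<lambda>t. ennreal (D t))) = (\<integral>t. D t *\<^sub>R L t *\<^sub>R g t \<partial>M)"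
    using D_nonneg by (intro integral_density) auto
  also have "(\<integral>t. L t \<partial>density M (\<lambda>t. ennreal (D t))) = (\<integral>t. D t *\<^sub>R L t \<partial>M)"
    using D_nonneg by (intro integral_density) auto
  finally show ?thesis
    by (simp add: mult.commute)
qed

section \<open>Covariance with a function known almost everywhere\<close>

text \<open>The usual expansion of the centred product. \<open>U\<close> is an integrable Borel
  version of \<open>T\<close>; passing to it inside the completion changes no integral.\<close>

lemma Cov_eq:
  fixes g :: "'a \<Rightarrow> real ^ 's"
  assumes "prob_space P"
    and g: "integrable P g" and U: "integrable P U" and Ug: "integrable P (\<lambda>t. U t *\<^sub>R g t)"
    and T: "AE t in P. T t = U t"
  shows "Cov P g T = (\<integral>t. U t *\<^sub>R g t \<partial>P) - (\<integral>t. U t \<partial>P) *\<^sub>R (\<integral>t. g t \<partial>P)"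
proof -
  interpret prob_space P by fact
  have [measurable]: "U \<in> borel_measurable P" "g \<in> borel_measurable P"
    using U g by auto
  have TU: "AE t in completion P. T t = U t"
    using T by (rule AE_completion)
  \<comment> \<open>The completion contains all subsets of null sets, so a preimage under
    \<open>T\<close> is measurable once it agrees almost everywhere with the preimage under
    \<open>U\<close>.\<close>
  have [measurable]: "T \<in> borel_measurable (completion P)"
  proof (rule measurableI)
    fix A :: "real set" assume A [measurable]: "A \<in> sets borel"
    have U_A: "U -` A \<inter> space P \<in> sets (completion P)"
      by (intro sets_completionI_sets measurable_sets) measurable
    have "AE t in completion P. t \<in> U -` A \<inter> space P \<longleftrightarrow> t \<in> T -` A \<inter> space (completion P)"
      using TU by eventually_elim simp
    then show "T -` A \<inter> space (completion P) \<in> sets (completion P)"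
      using U_A by (rule completion.in_sets_AE) (rule Int_lower2)
  qed simp
  have [measurable]: "(\<lambda>t. g t $ j) \<in> borel_measurable P" for j
    by (rule measurable_compose[OF \<open>g \<in> borel_measurable P\<close>])
      (intro borel_measurable_continuous_onI continuous_intros)
  have [measurable]: "U \<in> borel_measurable (completion P)"
      "(\<lambda>t. g t $ j) \<in> borel_measurable (completion P)" for j
    by (auto intro: measurable_completion)
  define m c where "m = (\<integral>t. g t \<partial>P)" and "c = (\<integral>t. U t \<partial>P)"
  have mean_T: "(\<integral>t. T t \<partial>completion P) = c"
    unfolding c_def using TU by (subst integral_cong_AE[where g = U]) (auto simp: integral_completion)
  have mean_g: "(\<integral>t. g t $ j \<partial>completion P) = m $ j" for j
    using integral_bounded_linear[OF bounded_linear_vec_nth g, of j]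
    by (simp add: integral_completion m_def)
  \<comment> \<open>Keeping the centred product as a vector lets one expansion serve all components;
    the \<open>j\<close>-th one is the integrand in \<open>Cov\<close>.\<close>
  have Ucgm: "(U t - c) *\<^sub>R (g t - m) = U t *\<^sub>R g t - U t *\<^sub>R m - c *\<^sub>R g t + c *\<^sub>R m" for t
    by (simp add: algebra_simps)
  have int: "integrable P (\<lambda>t. (U t - c) *\<^sub>R (g t - m))"
    unfolding Ucgm using g U Ug by simp
  have "Cov P g T $ j = (\<integral>t. (U t - c) *\<^sub>R (g t - m) \<partial>P) $ j" for j
  proof -
    have "Cov P g T $ j = (\<integral>t. (g t $ j - m $ j) * (T t - c) \<partial>completion P)"
      by (simp add: Cov_def mean_T mean_g)
    also have "\<dots> = (\<integral>t. (g t $ j - m $ j) * (U t - c) \<partial>completion P)"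
      using TU by (intro integral_cong_AE) auto
    also have "\<dots> = (\<integral>t. (g t $ j - m $ j) * (U t - c) \<partial>P)"
      by (intro integral_completion) measurable
    also have "\<dots> = (\<integral>t. ((U t - c) *\<^sub>R (g t - m)) $ j \<partial>P)"
      by (simp add: mult.commute)
    also have "\<dots> = (\<integral>t. (U t - c) *\<^sub>R (g t - m) \<partial>P) $ j"
      by (rule integral_bounded_linear[OF bounded_linear_vec_nth int])
    finally show ?thesis .
  qed
  then have "Cov P g T = (\<integral>t. (U t - c) *\<^sub>R (g t - m) \<partial>P)"
    by (simp add: vec_eq_iff)
  also have "\<dots> = (\<integral>t. U t *\<^sub>R g t \<partial>P) - c *\<^sub>R m"
    unfolding Ucgm using g U Ug by (simp add: m_def c_def prob_space)
  finally show ?thesis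
    by (simp add: m_def c_def)
qed

text \<open>The second domination, by \<open>G\<^sub>1\<close>, is for the normaliser: a bound on
  increments multiplied by \<open>g\<close> says nothing where \<open>g\<close> vanishes. The
  differentiability conjunct gives \<open>local_sensitivity\<close> its meaning, since
  \<open>vector_derivative\<close> has some value even where no derivative exists.\<close>

theorem theorem2:
  fixes \<Theta> :: "(real ^ 'k) set"
    and prior :: "(real ^ 'k) measure"
    and f\<^sub>\<theta> :: "real ^ 'k \<Rightarrow> real"
    and f\<^sub>X :: "real ^ 'k \<Rightarrow> real ^ 'd \<Rightarrow> real"
    and n :: nat and x :: "nat \<Rightarrow> real ^ 'd"
    and h :: "real \<Rightarrow> real \<Rightarrow> real" and \<alpha>\<^sub>0 \<delta>\<^sub>0 :: real
    and g :: "real ^ 'k \<Rightarrow> real ^ 's"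
    and G G\<^sub>1 :: "real ^ 'k \<Rightarrow> real"
  defines "L \<equiv> likelihood f\<^sub>X n x"
    and "F \<equiv> distribution_fun prior"
    and "h' \<equiv> \<lambda>\<alpha>. distortion_deriv (h \<alpha>)"
  assumes model: "bayesian_model \<Theta> prior f\<^sub>\<theta> f\<^sub>X"
    and bayes_rule: "integrable prior L" "0 < (\<integral>\<theta>. L \<theta> \<partial>prior)"
    and distortion: "\<And>\<alpha>. distortion_function (h \<alpha>)"
    and undistorted: "\<And>y. y \<in> {0..1} \<Longrightarrow> h \<alpha>\<^sub>0 y = y"
    and log_differentiable:
      "AE \<theta> in prior. (\<forall>\<^sub>F \<alpha> in nhds \<alpha>\<^sub>0. 0 < h' \<alpha> (F \<theta>)) \<and>
                   (\<lambda>\<alpha>. ln (h' \<alpha> (F \<theta>))) differentiable (at \<alpha>\<^sub>0)"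
    and delta0: "0 < \<delta>\<^sub>0"
    and g_measurable: "g \<in> borel_measurable prior"
    and g_mean: "integrable (posterior prior L) g"
    and G_integrable: "integrable prior G"
    and domination:
      "AE \<theta> in prior. \<forall>\<delta>. \<delta> \<noteq> 0 \<and> \<bar>\<delta>\<bar> \<le> \<delta>\<^sub>0 \<longrightarrow>
         norm ((inverse \<delta> * L \<theta> * (h' (\<alpha>\<^sub>0 + \<delta>) (F \<theta>) - h' \<alpha>\<^sub>0 (F \<theta>))) *\<^sub>R g \<theta>) \<le> G \<theta>"
    and G1_integrable: "integrable prior G\<^sub>1"
    and domination_normaliser:
      "AE \<theta> in prior. \<forall>\<delta>. \<delta> \<noteq> 0 \<and> \<bar>\<delta>\<bar> \<le> \<delta>\<^sub>0 \<longrightarrow>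
         \<bar>inverse \<delta> * L \<theta> * (h' (\<alpha>\<^sub>0 + \<delta>) (F \<theta>) - h' \<alpha>\<^sub>0 (F \<theta>))\<bar> \<le> G\<^sub>1 \<theta>"
  shows "(\<lambda>\<alpha>. posterior_mean (h \<alpha>) prior L g) differentiable (at \<alpha>\<^sub>0) \<and>
         local_sensitivity h \<alpha>\<^sub>0 prior L g =
           Cov (posterior prior L) g (\<lambda>\<theta>. deriv (\<lambda>\<alpha>. ln (h' \<alpha> (F \<theta>))) \<alpha>\<^sub>0)"
proof -

  \<comment> \<open>Measurability and sign of the likelihood and the density weight\<close>
  interpret bayesian_model \<Theta> prior f\<^sub>\<theta> f\<^sub>X
    by (rule model)
  have space: "space prior = \<Theta>"
    by (subst prior_eq) (simp add: space_restrict_space)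
  have sets_prior: "sets prior = sets (restrict_space borel \<Theta>)"
    by (subst prior_eq) (simp add: sets_restrict_space)
  have [measurable]: "L \<in> borel_measurable prior"
    using bayes_rule by auto
  note g_measurable [measurable]
  have L_nonneg: "0 \<le> L \<theta>" if "\<theta> \<in> space prior" for \<theta>
    using that by (auto simp: L_def likelihood_def space intro!: prod_nonneg model_density_nonneg)
  have "(\<lambda>\<theta>. \<theta>) \<in> borel_measurable prior"
    unfolding measurable_cong_sets[OF sets_prior refl] by (rule measurable_restrict_space1) simp
  then have F_meas [measurable]: "F \<in> borel_measurable prior"
    unfolding F_def by (intro borel_measurable_distribution_fun prob_space_axioms)
  have F_range: "F \<theta> \<in> {0..1}" for \<theta>
    unfolding F_def by (rule distribution_fun_range[OF prob_space_axioms])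
  define D where "D \<alpha> \<theta> = h' \<alpha> (F \<theta>)" for \<alpha> \<theta>
  have D_meas [measurable]: "D \<alpha> \<in> borel_measurable prior" for \<alpha>
    unfolding D_def h'_def
    by (intro borel_measurable_distortion_deriv_comp distortion F_meas F_range)
  have D_nonneg: "0 \<le> D \<alpha> \<theta>" for \<alpha> \<theta>
    unfolding D_def h'_def by (intro distortion_deriv_nonneg distortion F_range)
  \<comment> \<open>Hence all integrals at \<open>\<alpha>\<^sub>0\<close> are those of the
    undistorted posterior, and differentiating \<open>D\<close> or its logarithm there gives the
    same result.\<close>
  have D_base: "D \<alpha>\<^sub>0 \<theta> = 1" for \<theta>
    unfolding D_def h'_def by (intro distortion_deriv_eq_1 undistorted F_range)

  \<comment> \<open>Pointwise derivative of the density weight in the parameter\<close>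
  define T where "T \<theta> = deriv (\<lambda>\<alpha>. ln (D \<alpha> \<theta>)) \<alpha>\<^sub>0" for \<theta>
  have D_deriv: "AE \<theta> in prior. ((\<lambda>\<alpha>. D \<alpha> \<theta>) has_real_derivative T \<theta>) (at \<alpha>\<^sub>0)"
    using log_differentiable
  proof eventually_elim
    case (elim \<theta>)
    \<comment> \<open>Recovering \<open>D\<close> from its logarithm requires positivity on a whole
      neighbourhood of \<open>\<alpha>\<^sub>0\<close>, which may depend on \<open>\<theta>\<close>.
      The chain rule factor \<open>exp (ln (D \<alpha>\<^sub>0 \<theta>))\<close> is then 1.\<close>
    have pos: "\<forall>\<^sub>F \<alpha> in nhds \<alpha>\<^sub>0. exp (ln (D \<alpha> \<theta>)) = D \<alpha> \<theta>"
      using conjunct1[OF elim] by eventually_elim (simp add: D_def)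
    have "((\<lambda>\<alpha>. ln (D \<alpha> \<theta>)) has_real_derivative T \<theta>) (at \<alpha>\<^sub>0)"
      using conjunct2[OF elim] unfolding T_def D_def by (simp add: DERIV_deriv_iff_real_differentiable)
    then have "((\<lambda>\<alpha>. exp (ln (D \<alpha> \<theta>))) has_real_derivative exp (ln (D \<alpha>\<^sub>0 \<theta>)) * T \<theta>) (at \<alpha>\<^sub>0)"
      by (rule DERIV_fun_exp)
    then have "((\<lambda>\<alpha>. D \<alpha> \<theta>) has_real_derivative exp (ln (D \<alpha>\<^sub>0 \<theta>)) * T \<theta>) (at \<alpha>\<^sub>0)"
      using DERIV_cong_ev[OF refl pos refl] by blast
    then show ?case
      by (simp add: D_base)
  qed

  \<comment> \<open>A Borel version of \<open>T\<close>, which is only specified almost everywhere.\<close>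
  define U where "U \<theta> = lim (\<lambda>k. (D (\<alpha>\<^sub>0 + inverse (real (Suc k))) \<theta> - D \<alpha>\<^sub>0 \<theta>) * real (Suc k))"
    for \<theta>
  \<comment> \<open>The set of convergence is measurable, and off it \<open>lim\<close> takes one
    fixed unspecified value, so \<open>U\<close> is measurable everywhere.\<close>
  have U_meas [measurable]: "U \<in> borel_measurable prior"
    unfolding U_def by measurable
  have TU: "AE \<theta> in prior. T \<theta> = U \<theta>"
    using D_deriv
  proof eventually_elim
    case (elim \<theta>)
    have "((\<lambda>y. (D (\<alpha>\<^sub>0 + y) \<theta> - D \<alpha>\<^sub>0 \<theta>) / y) \<longlongrightarrow> T \<theta>) (at 0)"
      using elim by (simp add: DERIV_def)
    moreover have "filterlim (\<lambda>k. inverse (real (Suc k))) (at 0) sequentially"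
      using LIMSEQ_inverse_real_of_nat by (auto simp: filterlim_at)
    ultimately have "(\<lambda>k. (D (\<alpha>\<^sub>0 + inverse (real (Suc k))) \<theta> - D \<alpha>\<^sub>0 \<theta>) / inverse (real (Suc k)))
        \<longlonglongrightarrow> T \<theta>"
      by (rule filterlim_compose)
    then show ?case
      unfolding U_def by (intro limI[symmetric]) (simp add: divide_inverse)
  qed
  have deriv: "AE \<theta> in prior. ((\<lambda>\<alpha>. D \<alpha> \<theta>) has_real_derivative U \<theta>) (at \<alpha>\<^sub>0)"
    using D_deriv TU by eventually_elim simp

  \<comment> \<open>Dominated difference quotients of numerator and normaliser\<close>
  have L_nonneg_AE: "AE \<theta> in prior. 0 \<le> L \<theta>"
    using L_nonneg by (rule AE_I2)
  have int_Lg: "integrable prior (\<lambda>\<theta>. L \<theta> *\<^sub>R g \<theta>)"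
    using g_mean L_nonneg_AE bayes_rule(2) by (subst (asm) integrable_posterior_iff) auto
  have deriv_g: "AE \<theta> in prior.
      ((\<lambda>\<alpha>. (L \<theta> * D \<alpha> \<theta>) *\<^sub>R g \<theta>) has_vector_derivative (L \<theta> * U \<theta>) *\<^sub>R g \<theta>) (at \<alpha>\<^sub>0)"
    using deriv
  proof eventually_elim
    case (elim \<theta>)
    have "((\<lambda>\<alpha>. L \<theta> * D \<alpha> \<theta>) has_real_derivative L \<theta> * U \<theta>) (at \<alpha>\<^sub>0)"
      using elim by (rule DERIV_cmult)
    from has_vector_derivative_scaleR[OF this has_vector_derivative_const]
    show ?case
      by simp
  qed
  have deriv_1: "AE \<theta> in prior. ((\<lambda>\<alpha>. L \<theta> * D \<alpha> \<theta>) has_vector_derivative L \<theta> * U \<theta>) (at \<alpha>\<^sub>0)"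
    using deriv
    by eventually_elim (simp add: DERIV_cmult flip: has_real_derivative_iff_has_vector_derivative)
  \<comment> \<open>The hypothesis with increment \<open>\<alpha> - \<alpha>\<^sub>0\<close>:
    factoring the quotient of the weighted \<open>g\<close> produces exactly the dominated
    expression.\<close>
  have bound_g: "AE \<theta> in prior. \<forall>\<alpha>. \<alpha> \<noteq> \<alpha>\<^sub>0 \<and> \<bar>\<alpha> - \<alpha>\<^sub>0\<bar> \<le> \<delta>\<^sub>0 \<longrightarrow>
      norm (((L \<theta> * D \<alpha> \<theta>) *\<^sub>R g \<theta> - (L \<theta> * D \<alpha>\<^sub>0 \<theta>) *\<^sub>R g \<theta>) /\<^sub>R (\<alpha> - \<alpha>\<^sub>0)) \<le> G \<theta>"
    using domination
  proof eventually_elim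
    case (elim \<theta>)
    show ?case
    proof (intro allI impI)
      fix \<alpha> assume "\<alpha> \<noteq> \<alpha>\<^sub>0 \<and> \<bar>\<alpha> - \<alpha>\<^sub>0\<bar> \<le> \<delta>\<^sub>0"
      then have "norm ((inverse (\<alpha> - \<alpha>\<^sub>0) * L \<theta> * (D \<alpha> \<theta> - D \<alpha>\<^sub>0 \<theta>)) *\<^sub>R g \<theta>) \<le> G \<theta>"
        using elim[rule_format, of "\<alpha> - \<alpha>\<^sub>0"] by (simp add: D_def)
      moreover have "((L \<theta> * D \<alpha> \<theta>) *\<^sub>R g \<theta> - (L \<theta> * D \<alpha>\<^sub>0 \<theta>) *\<^sub>R g \<theta>) /\<^sub>R (\<alpha> - \<alpha>\<^sub>0) =
          (inverse (\<alpha> - \<alpha>\<^sub>0) * L \<theta> * (D \<alpha> \<theta> - D \<alpha>\<^sub>0 \<theta>)) *\<^sub>R g \<theta>"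
        by (simp add: right_diff_distrib mult.assoc flip: scaleR_diff_left)
      ultimately show "norm (((L \<theta> * D \<alpha> \<theta>) *\<^sub>R g \<theta> - (L \<theta> * D \<alpha>\<^sub>0 \<theta>) *\<^sub>R g \<theta>) /\<^sub>R (\<alpha> - \<alpha>\<^sub>0)) \<le> G \<theta>"
        by simp
    qed
  qed
  have bound_1: "AE \<theta> in prior. \<forall>\<alpha>. \<alpha> \<noteq> \<alpha>\<^sub>0 \<and> \<bar>\<alpha> - \<alpha>\<^sub>0\<bar> \<le> \<delta>\<^sub>0 \<longrightarrow>
      norm ((L \<theta> * D \<alpha> \<theta> - L \<theta> * D \<alpha>\<^sub>0 \<theta>) /\<^sub>R (\<alpha> - \<alpha>\<^sub>0)) \<le> G\<^sub>1 \<theta>"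
    using domination_normaliser
  proof eventually_elim
    case (elim \<theta>)
    show ?case
    proof (intro allI impI)
      fix \<alpha> assume "\<alpha> \<noteq> \<alpha>\<^sub>0 \<and> \<bar>\<alpha> - \<alpha>\<^sub>0\<bar> \<le> \<delta>\<^sub>0"
      then have "\<bar>inverse (\<alpha> - \<alpha>\<^sub>0) * L \<theta> * (D \<alpha> \<theta> - D \<alpha>\<^sub>0 \<theta>)\<bar> \<le> G\<^sub>1 \<theta>"
        using elim[rule_format, of "\<alpha> - \<alpha>\<^sub>0"] by (simp add: D_def)
      then show "norm ((L \<theta> * D \<alpha> \<theta> - L \<theta> * D \<alpha>\<^sub>0 \<theta>) /\<^sub>R (\<alpha> - \<alpha>\<^sub>0)) \<le> G\<^sub>1 \<theta>"
        by (simp add: right_diff_distrib mult.assoc)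
    qed
  qed

  \<comment> \<open>Differentiating the posterior mean by the quotient rule\<close>
  define N where "N \<alpha> = (\<integral>\<theta>. (L \<theta> * D \<alpha> \<theta>) *\<^sub>R g \<theta> \<partial>prior)" for \<alpha>
  define Z where "Z \<alpha> = (\<integral>\<theta>. L \<theta> * D \<alpha> \<theta> \<partial>prior)" for \<alpha>
  define N' where "N' = (\<integral>\<theta>. (L \<theta> * U \<theta>) *\<^sub>R g \<theta> \<partial>prior)"
  define Z' where "Z' = (\<integral>\<theta>. L \<theta> * U \<theta> \<partial>prior)"
  have int_g: "integrable prior (\<lambda>\<theta>. (L \<theta> * D \<alpha>\<^sub>0 \<theta>) *\<^sub>R g \<theta>)"
    and int_1: "integrable prior (\<lambda>\<theta>. L \<theta> * D \<alpha>\<^sub>0 \<theta>)"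
    using int_Lg bayes_rule(1) by (simp_all add: D_base)
  \<comment> \<open>Besides the derivative of \<open>N\<close>, domination gives integrability of
    the limit, which is needed later to expand the covariance.\<close>
  have int_LUg: "integrable prior (\<lambda>\<theta>. (L \<theta> * U \<theta>) *\<^sub>R g \<theta>)"
    by (rule integrable_dominated_derivative[OF _ _ int_g deriv_g delta0 G_integrable bound_g]) measurable
  have N_deriv: "(N has_vector_derivative N') (at \<alpha>\<^sub>0)"
    unfolding N_def[abs_def] N'_def
    by (rule has_vector_derivative_integral_dominated[OF _ _ int_g deriv_g delta0 G_integrable bound_g])
      measurable
  have int_LU: "integrable prior (\<lambda>\<theta>. L \<theta> * U \<theta>)"
    by (rule integrable_dominated_derivative[OF _ _ int_1 deriv_1 delta0 G1_integrable bound_1]) measurable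
  have "(Z has_vector_derivative Z') (at \<alpha>\<^sub>0)"
    unfolding Z_def[abs_def] Z'_def
    by (rule has_vector_derivative_integral_dominated[OF _ _ int_1 deriv_1 delta0 G1_integrable bound_1])
      measurable
  then have Z_deriv: "(Z has_real_derivative Z') (at \<alpha>\<^sub>0)"
    by (simp add: has_real_derivative_iff_has_vector_derivative)
  have Z_pos: "0 < Z \<alpha>\<^sub>0"
    using bayes_rule(2) by (simp add: Z_def D_base)

  \<comment> \<open>Valid for every \<open>\<alpha>\<close>: if \<open>Z \<alpha>\<close> is 0, both
    sides are 0. Positivity of \<open>Z\<close> is therefore used only at
    \<open>\<alpha>\<^sub>0\<close>.\<close>
  have mean: "posterior_mean (h \<alpha>) prior L g = inverse (Z \<alpha>) *\<^sub>R N \<alpha>" for \<alpha>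
    using D_meas[of \<alpha>] D_nonneg[of \<alpha>] L_nonneg unfolding Z_def N_def D_def h'_def F_def
    by (intro posterior_mean_eq) auto
  have "((\<lambda>\<alpha>. inverse (Z \<alpha>) *\<^sub>R N \<alpha>) has_vector_derivative
      inverse (Z \<alpha>\<^sub>0) *\<^sub>R N' + (- (inverse (Z \<alpha>\<^sub>0) * Z' * inverse (Z \<alpha>\<^sub>0))) *\<^sub>R N \<alpha>\<^sub>0) (at \<alpha>\<^sub>0)"
    using Z_pos by (intro has_vector_derivative_scaleR DERIV_inverse' Z_deriv N_deriv) simp
  \<comment> \<open>The second term is regrouped as a product of
    \<open>Z' / Z \<alpha>\<^sub>0\<close> and
    \<open>N \<alpha>\<^sub>0 /\<^sub>R Z \<alpha>\<^sub>0\<close>, which are the posterior means of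
    \<open>U\<close> and \<open>g\<close>.\<close>
  then have mean_deriv: "((\<lambda>\<alpha>. posterior_mean (h \<alpha>) prior L g) has_vector_derivative
      N' /\<^sub>R Z \<alpha>\<^sub>0 - (Z' / Z \<alpha>\<^sub>0) *\<^sub>R (N \<alpha>\<^sub>0 /\<^sub>R Z \<alpha>\<^sub>0)) (at \<alpha>\<^sub>0)"
    by (simp add: mean[abs_def] divide_inverse mult.commute mult.left_commute)

  \<comment> \<open>Identification with the posterior covariance\<close>
  have E: "(\<integral>\<theta>. U \<theta> *\<^sub>R g \<theta> \<partial>posterior prior L) = N' /\<^sub>R Z \<alpha>\<^sub>0"
    "(\<integral>\<theta>. U \<theta> \<partial>posterior prior L) = Z' / Z \<alpha>\<^sub>0"
    "(\<integral>\<theta>. g \<theta> \<partial>posterior prior L) = N \<alpha>\<^sub>0 /\<^sub>R Z \<alpha>\<^sub>0"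
    using L_nonneg_AE
    by (simp_all add: integral_posterior N'_def Z'_def N_def Z_def D_base divide_inverse mult.commute)
  have "Cov (posterior prior L) g T =
      (\<integral>\<theta>. U \<theta> *\<^sub>R g \<theta> \<partial>posterior prior L) -
      (\<integral>\<theta>. U \<theta> \<partial>posterior prior L) *\<^sub>R (\<integral>\<theta>. g \<theta> \<partial>posterior prior L)"
  proof (rule Cov_eq[OF _ g_mean])
    show "prob_space (posterior prior L)"
      using bayes_rule L_nonneg_AE by (intro prob_space_posterior)
    show "integrable (posterior prior L) U"
      using int_LU L_nonneg_AE bayes_rule(2) by (subst integrable_posterior_iff) auto
    show "integrable (posterior prior L) (\<lambda>\<theta>. U \<theta> *\<^sub>R g \<theta>)"
      using int_LUg L_nonneg_AE bayes_rule(2) by (subst integrable_posterior_iff) auto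
    show "AE \<theta> in posterior prior L. T \<theta> = U \<theta>"
      using TU by (intro AE_posterior) auto
  qed
  then have "Cov (posterior prior L) g T = N' /\<^sub>R Z \<alpha>\<^sub>0 - (Z' / Z \<alpha>\<^sub>0) *\<^sub>R (N \<alpha>\<^sub>0 /\<^sub>R Z \<alpha>\<^sub>0)"
    by (simp only: E)
  then have "local_sensitivity h \<alpha>\<^sub>0 prior L g = Cov (posterior prior L) g T"
    unfolding local_sensitivity_def using vector_derivative_at[OF mean_deriv] by simp
  then show ?thesis
    using differentiableI_vector[OF mean_deriv] by (simp add: T_def[abs_def] D_def)
qed

end
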